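(* Let $r$ and $n$ be positive integers and let $\omega$ be a primitive $r$th root of $1$. For any integer $b$ with $0\le b\le r-1$, $$\sum_{\pi\in G_{r,2n}} \chi_{1,b}(\pi)\,t^{\mathrm{fdes}(\pi)}q^{\mathrm{fmaj}(\pi)}x^{\mathrm{col}(\pi)} = \prod_{i=1}^{n}\left(1-t^rq^{r(2i-1)}\right)\sum_{\pi\in G_{r,n}}t^{\mathrm{fdes}(\pi)}(\omega^bq)^{2\,\mathrm{fmaj}(\pi)}x^{2\,\mathrm{col}(\pi)}.$$
   Context: Here $t,q,x$ are commuting indeterminates. For positive integers $r,N$, $G_{r,N}=\mathbb{Z}_r\wr\mathfrak{S}_N$ is the group of colored permutations: its elements are pairs $\pi=(\sigma,\mathbf z)$ with $\sigma=\sigma_1\cdots\sigma_N\in\mathfrak S_N$ and $\mathbf z=(z_1,\dots,z_N)$, where each color $z_i\in\mathbb Z_r$ is represented by an integer in $\{0,1,\dots,r-1\}$. One writes $\pi=\pi_1\pi_2\cdots\pi_N$ with $\pi_i=\sigma_i^{[z_i]}$ (superscript $[0]$ omitted). Color sum: $\mathrm{col}(\pi)=\sum_{i=1}^N z_i$ (an integer). Length: $\ell(\pi)=\mathrm{inv}(\pi)+\sum_{i:\,z_i>0}(\sigma_i+z_i-1)$, where $\mathrm{inv}(\pi)=|\{(i,j): i<j,\ \pi_i>\pi_j\}|$ is computed with respect to the linear order $N^{[r-1]}<\cdots<N^{[1]}<\cdots<1^{[r-1]}<\cdots<1^{[1]}<1<\cdots<N$. (This is the minimal number of generators $s_0,s_1,\dots,s_{N-1}$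 needed to express $\pi$, where $s_i=(i,i+1)$ for $i\ge1$ and $s_0$ adds $1$ to the color of the first letter.) One-dimensional characters: $\chi_{a,b}(\pi)=(-1)^{a(\ell(\pi)-\mathrm{col}(\pi))}\omega^{b\,\mathrm{col}(\pi)}$ for $a\in\{0,1\}$, $0\le b\le r-1$. Flag statistics: $\mathrm{Des}_F(\pi)=\{i\in\{1,\dots,N-1\}:\pi_i>\pi_{i+1}\}$ with respect to the (different) linear order $1^{[r-1]}<\cdots<N^{[r-1]}<\cdots<1^{[1]}<\cdots<N^{[1]}<1<\cdots<N$; $\mathrm{des}_F(\pi)=|\mathrm{Des}_F(\pi)|$, $\mathrm{maj}_F(\pi)=\sum_{i\in\mathrm{Des}_F(\pi)}i$, $\mathrm{fdes}(\pi)=r\cdot\mathrm{des}_F(\pi)+z_1$, and $\mathrm{fmaj}(\pi)=r\cdot\mathrm{maj}_F(\pi)+\mathrm{col}(\pi)$. *)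

theory Defs
  imports
    Complex_Main
    "HOL-Library.FuncSet"
    "HOL-Combinatorics.Permutations"
    "HOL-Computational_Algebra.Polynomial"
begin

(* A colored permutation (sigma, z) of size N is a pair of functions read on {1..N}:
   sigma permutes {1..N} (identity elsewhere) and z i < r is the representative of the i-th color
   (undefined elsewhere), so that distinct pairs are distinct group elements. *)
type_synonym cperm = "(nat \<Rightarrow> nat) \<times> (nat \<Rightarrow> nat)"

definition colored_perms :: "nat \<Rightarrow> nat \<Rightarrow> cperm set" where
  "colored_perms r N = {\<sigma>. \<sigma> permutes {1..N}} \<times> ({1..N} \<rightarrow>\<^sub>E {0..<r})"

(* The pair (s, c) stands for the letter s with color c. *)
definition letter :: "cperm \<Rightarrow> nat \<Rightarrow> nat \<times> nat" where
  "letter \<pi> i = (fst \<pi> i, snd \<pi> i)"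

(* N^[r-1] < ... < N^[1] < ... < 1^[r-1] < ... < 1^[1] < 1 < ... < N *)
fun length_less :: "nat \<times> nat \<Rightarrow> nat \<times> nat \<Rightarrow> bool" where
  "length_less (s, c) (s', c') \<longleftrightarrow>
     (if c > 0 \<and> c' > 0 then s > s' \<or> (s = s' \<and> c > c')
      else if c = 0 \<and> c' = 0 then s < s'
      else c > 0)"

(* 1^[r-1] < ... < N^[r-1] < ... < 1^[1] < ... < N^[1] < 1 < ... < N *)
fun flag_less :: "nat \<times> nat \<Rightarrow> nat \<times> nat \<Rightarrow> bool" where
  "flag_less (s, c) (s', c') \<longleftrightarrow> c > c' \<or> (c = c' \<and> s < s')"

definition col :: "nat \<Rightarrow> cperm \<Rightarrow> nat" where
  "col N \<pi> = (\<Sum>i\<in>{1..N}. snd \<pi> i)"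

definition inversions :: "nat \<Rightarrow> cperm \<Rightarrow> nat" where
  "inversions N \<pi> =
     card {(i, j). i \<in> {1..N} \<and> j \<in> {1..N} \<and> i < j \<and> length_less (letter \<pi> j) (letter \<pi> i)}"

(* The truncated subtraction is exact: fst \<pi> i \<ge> 1 for i in {1..N}. *)
definition clength :: "nat \<Rightarrow> cperm \<Rightarrow> nat" where
  "clength N \<pi> =
     inversions N \<pi> + (\<Sum>i\<in>{i\<in>{1..N}. snd \<pi> i > 0}. fst \<pi> i + snd \<pi> i - 1)"

(* The truncated subtraction is exact: clength N \<pi> \<ge> col N \<pi> on colored_perms r N. *)
definition chi :: "complex \<Rightarrow> nat \<Rightarrow> nat \<Rightarrow> nat \<Rightarrow> cperm \<Rightarrow> complex" where
  "chi \<omega> N a b \<pi> = (-1) ^ (a * (clength N \<pi> - col N \<pi>)) * \<omega> ^ (b * col N \<pi>)"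

definition Des_F :: "nat \<Rightarrow> cperm \<Rightarrow> nat set" where
  "Des_F N \<pi> = {i \<in> {1..N - 1}. flag_less (letter \<pi> (i + 1)) (letter \<pi> i)}"

definition des_F :: "nat \<Rightarrow> cperm \<Rightarrow> nat" where
  "des_F N \<pi> = card (Des_F N \<pi>)"

definition maj_F :: "nat \<Rightarrow> cperm \<Rightarrow> nat" where
  "maj_F N \<pi> = (\<Sum>i\<in>Des_F N \<pi>. i)"

definition fdes :: "nat \<Rightarrow> nat \<Rightarrow> cperm \<Rightarrow> nat" where
  "fdes r N \<pi> = r * des_F N \<pi> + snd \<pi> 1"

definition fmaj :: "nat \<Rightarrow> nat \<Rightarrow> cperm \<Rightarrow> nat" where
  "fmaj r N \<pi> = r * maj_F N \<pi> + col N \<pi>"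

definition primitive_root_of_1 :: "nat \<Rightarrow> complex \<Rightarrow> bool" where
  "primitive_root_of_1 r \<omega> \<longleftrightarrow> \<omega> ^ r = 1 \<and> (\<forall>k. 0 < k \<and> k < r \<longrightarrow> \<omega> ^ k \<noteq> 1)"

(* The polynomial ring C[t, q, x] as the iterated ring C[t][q][x]. *)
type_synonym poly3 = "complex poly poly poly"

definition scalar :: "complex \<Rightarrow> poly3" where
  "scalar c = [:[:[:c:]:]:]"

definition var_t :: poly3 where
  "var_t = [:[:[:0, 1:]:]:]"

definition var_q :: poly3 where
  "var_q = [:[:0, 1:]:]"

definition var_x :: poly3 where
  "var_x = [:0, 1:]"

end

theory Submission
  imports Defs
begin

text \<open>
  The factor \<open>(-1) ^ (clength - col)\<close> of the character is the sign of the underlying permutation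
  (\<open>minus_one_power_length\<close>), so the left-hand side of \<open>theorem1\<close> is a signed sum over colored
  permutations of size \<open>2 n\<close>, to which a sign-reversing involution applies. Since \<open>\<omega> ^ r = 1\<close>, the
  factor \<open>\<omega> ^ b\<close> enters only through \<open>col\<close>, and it is absorbed by rescaling \<open>x\<close>.

  Exchange the letters with values \<open>2 k - 1\<close> and \<open>2 k\<close>, leaving the colors in their positions. Two
  values with nothing between them compare in the same way with every other letter, so in the flag
  order a comparison of neighbouring letters can only change if these are the two exchanged letters,
  standing side by side with the same color. If this is not the case, then the exchange preserves
  descents and colors and reverses the sign (\<open>signed_weight_swap_values\<close>). Whether \<open>2 k - 1\<close> and
  \<open>2 k\<close> stand side by side with the same color, called \<open>coupled\<close> below, is not affected by any of
  these exchanges. Applying the exchange for the least \<open>k\<close> that is not coupled is therefore an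
  involution, and all permutations with such a \<open>k\<close> cancel (\<open>sum_signed_weight_uncoupled\<close>).

  In the remaining permutations each pair of values occupies two neighbouring positions. A segment
  of even length has only one tiling by dominoes, so the pairs occupy the positions \<open>2 j - 1\<close> and
  \<open>2 j\<close> (\<open>coupled_aligned\<close>). Such a permutation is a colored permutation \<open>\<tau>\<close> of size \<open>n\<close> in which every
  letter has been replaced by a domino, together with the set \<open>S\<close> of dominoes that are written in
  decreasing order (\<open>coupled_halve\<close>, \<open>dominoes_in_colored_perms\<close>). Its descents are \<open>2 j\<close> for the
  descents \<open>j\<close> of \<open>\<tau>\<close> and \<open>2 j - 1\<close> for \<open>j \<in> S\<close>, its color sum is twice that of \<open>\<tau>\<close>, and its sign
  is \<open>(-1) ^ card S\<close>. So each \<open>j \<in> S\<close> contributes \<open>- t ^ r * q ^ (r * (2 * j - 1))\<close>, and summing over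
  all \<open>S\<close> gives the product on the right-hand side (\<open>sum_signed_weight_coupled\<close>).
\<close>

section \<open>The sign of a word\<close>

text \<open>
  If \<open>w\<close> permutes \<open>{1..N}\<close>, this is its sign. The product makes sense for any \<open>w\<close>, so that the sign of
  a permutation can be computed by adding one position at a time, although the restriction of a
  permutation to an initial segment need not be a permutation.
\<close>

definition inversion_sign :: "nat \<Rightarrow> (nat \<Rightarrow> nat) \<Rightarrow> int" where
  "inversion_sign N w = (\<Prod>j\<in>{1..N}. \<Prod>i\<in>{1..<j}. if w j < w i then -1 else 1)"

lemma inversion_sign_Sigma:
  "inversion_sign N w =
     (\<Prod>(j, i)\<in>(SIGMA j:{1..N}. {1..<j}). if w j < w i then -1 else 1)"
  unfolding inversion_sign_def by (subst prod.Sigma) auto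

lemma inversion_sign_Suc:
  "inversion_sign (Suc N) w =
     inversion_sign N w * (\<Prod>i\<in>{1..N}. if w (Suc N) < w i then -1 else 1)"
proof -
  have "{1..<Suc N} = {1..N}" by auto
  then show ?thesis by (simp add: inversion_sign_def del: prod.op_ivl_Suc)
qed

lemma prod_off_diagonal:
  fixes u :: "nat \<Rightarrow> nat \<Rightarrow> 'a :: comm_monoid_mult"
  assumes "\<And>i. u i i = 1"
  shows "(\<Prod>i\<in>{1..N}. \<Prod>j\<in>{1..N}. u i j) =
         (\<Prod>(j, i)\<in>(SIGMA j:{1..N}. {1..<j}). u i j * u j i)"
proof -
  have "(\<Prod>i\<in>{1..N}. \<Prod>j\<in>{1..N}. u i j) = (\<Prod>j\<in>{1..N}. \<Prod>i\<in>{1..<j}. u i j * u j i)"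
  proof (induction N)
    case 0
    then show ?case by simp
  next
    case (Suc N)
    have ivl: "{1..<Suc N} = {1..N}" by auto
    have "(\<Prod>i\<in>{1..Suc N}. \<Prod>j\<in>{1..Suc N}. u i j)
        = (\<Prod>i\<in>{1..N}. \<Prod>j\<in>{1..N}. u i j) * (\<Prod>i\<in>{1..<Suc N}. u i (Suc N) * u (Suc N) i)"
      unfolding ivl by (simp add: prod.distrib assms ac_simps)
    also have "\<dots> = (\<Prod>j\<in>{1..Suc N}. \<Prod>i\<in>{1..<j}. u i j * u j i)"
      using Suc.IH by (simp del: prod.op_ivl_Suc)
    finally show ?case .
  qed
  then show ?thesis by (simp add: prod.Sigma)
qed

lemma minus_one_power_card:
  assumes "finite A"
  shows "(-1) ^ card {x \<in> A. P x} = (\<Prod>x\<in>A. if P x then -1 else 1 :: 'a :: comm_ring_1)"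
  using prod.inter_filter[OF assms, of "\<lambda>_. -1" P] by simp

lemma permutes_card_less:
  assumes "w permutes {1..N::nat}" "i \<in> {1..N}"
  shows "card {j \<in> {1..N}. w j < w i} = w i - 1"
proof -
  have "{j \<in> {1..N}. w j < w i} = w -` {1..<w i}"
  proof (rule set_eqI)
    fix j
    show "j \<in> {j \<in> {1..N}. w j < w i} \<longleftrightarrow> j \<in> w -` {1..<w i}"
      using assms permutes_in_image[OF assms(1), of i] permutes_in_image[OF assms(1), of j]
      by auto
  qed
  then show ?thesis
    using permutes_bij[OF assms(1)] by (simp add: card_vimage_inj bij_def)
qed

text \<open>
  A letter with color \<open>c > 0\<close> contributes its color both to \<open>col\<close> and, once, to \<open>clength\<close>; since the
  difference is nonnegative term by term, the truncated subtraction loses nothing.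
\<close>

lemma clength_minus_col:
  assumes "fst \<pi> permutes {1..N}"
  shows "clength N \<pi> - col N \<pi> = inversions N \<pi> + (\<Sum>i\<in>{i \<in> {1..N}. snd \<pi> i > 0}. fst \<pi> i - 1)"
proof -
  let ?C = "{i \<in> {1..N}. snd \<pi> i > 0}"
  have "fst \<pi> i \<ge> 1" if "i \<in> ?C" for i
    using that permutes_in_image[OF assms, of i] by auto
  then have "(\<Sum>i\<in>?C. fst \<pi> i + snd \<pi> i - 1) = (\<Sum>i\<in>?C. fst \<pi> i - 1) + (\<Sum>i\<in>?C. snd \<pi> i)"
    by (subst sum.distrib [symmetric], intro sum.cong) auto
  moreover have "col N \<pi> = (\<Sum>i\<in>?C. snd \<pi> i)"
    unfolding col_def by (intro sum.mono_neutral_right) auto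
  ultimately show ?thesis by (simp add: clength_def)
qed

text \<open>
  The length order and the order of the values disagree on two letters exactly if the one with the
  larger value is colored: a colored letter is below every letter of smaller value, and an uncolored
  one is above. A colored letter of value \<open>v\<close> exceeds \<open>v - 1\<close> other values, so it accounts for \<open>v - 1\<close>
  disagreements, which is its second contribution to \<open>clength - col\<close>; modulo 2 the two cancel.
\<close>

lemma minus_one_power_length:
  assumes "fst \<pi> permutes {1..N}"
  shows "(-1) ^ (clength N \<pi> - col N \<pi>) = inversion_sign N (fst \<pi>)"
proof -
  let ?w = "fst \<pi>" and ?z = "snd \<pi>"
  let ?P = "SIGMA j:{1..N}. {1..<j}"
  let ?L = "\<lambda>j i. length_less (letter \<pi> j) (letter \<pi> i)"
  \<comment> \<open>\<open>u i j\<close> is \<open>-1\<close> if the letter at \<open>i\<close> causes a disagreement with the one at \<open>j\<close>.\<close>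
  define u where "u i j = (if ?z i > 0 \<and> ?w j < ?w i then -1 else 1 :: int)" for i j
  have "inversions N \<pi> = card {(j, i) \<in> ?P. ?L j i}"
    unfolding inversions_def
    by (rule bij_betw_same_card[of prod.swap], rule bij_betwI[where g = prod.swap]) auto
  moreover have "{(j, i) \<in> ?P. ?L j i} = {x \<in> ?P. case x of (j, i) \<Rightarrow> ?L j i}"
    by auto
  ultimately have inv: "(-1) ^ inversions N \<pi> = (\<Prod>(j, i)\<in>?P. if ?L j i then -1 else 1 :: int)"
    using minus_one_power_card[of ?P "\<lambda>(j, i). ?L j i", where 'a = int]
    by (simp add: case_prod_unfold)
  have "(-1) ^ (\<Sum>i\<in>{i \<in> {1..N}. ?z i > 0}. ?w i - 1)
      = (\<Prod>i\<in>{1..N}. if ?z i > 0 then (-1) ^ (?w i - 1) else 1 :: int)"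
    unfolding power_sum by (rule prod.inter_filter) simp
  also have "\<dots> = (\<Prod>i\<in>{1..N}. \<Prod>j\<in>{1..N}. u i j)"
  proof (rule prod.cong[OF refl])
    fix i assume i: "i \<in> {1..N}"
    show "(if ?z i > 0 then (-1) ^ (?w i - 1) else 1) = (\<Prod>j\<in>{1..N}. u i j)"
      using minus_one_power_card[of "{1..N}" "\<lambda>j. ?w j < ?w i", where 'a = int]
      unfolding permutes_card_less[OF assms i] by (simp add: u_def)
  qed
  also have "\<dots> = (\<Prod>(j, i)\<in>?P. u i j * u j i)"
    by (rule prod_off_diagonal) (simp add: u_def)
  finally have "(-1) ^ (clength N \<pi> - col N \<pi>)
      = (\<Prod>(j, i)\<in>?P. (if ?L j i then -1 else 1) * (u i j * u j i))"
    by (simp add: clength_minus_col[OF assms] power_add inv prod.distrib case_prod_unfold)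
  also have "\<dots> = inversion_sign N ?w"
    unfolding inversion_sign_Sigma
  proof (rule prod.cong[OF refl], clarify)
    fix j i assume "j \<in> {1..N}" "i \<in> {1..<j}"
    then have "?w i \<noteq> ?w j"
      using permutes_inj[OF assms] by (auto simp: inj_eq)
    then show "(if ?L j i then -1 else 1) * (u i j * u j i) = (if ?w j < ?w i then -1 else 1)"
      by (cases "?z i > 0"; cases "?z j > 0") (auto simp: letter_def u_def)
  qed
  finally show ?thesis .
qed

lemma transpose_Suc_less_iff:
  assumes "a \<noteq> b" "{a, b} \<noteq> {k, Suc k}"
  shows "transpose k (Suc k) a < transpose k (Suc k) b \<longleftrightarrow> a < b"
  using assms by (auto simp: transpose_def)

lemma inversion_sign_transpose:
  assumes "w permutes {1..N}" "1 \<le> k" "Suc k \<le> N"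
  shows "inversion_sign N (transpose k (Suc k) \<circ> w) = - inversion_sign N w"
proof -
  let ?P = "SIGMA j:{1..N}. {1..<j}"
  let ?e = "\<lambda>w (j, i). if w j < w i then -1 else 1 :: int"
  define p q where "p = inv w k" and "q = inv w (Suc k)"
  have wpq: "w p = k" "w q = Suc k"
    using permutes_inverses[OF assms(1)] by (auto simp: p_def q_def)
  then have "p \<noteq> q" by auto
  have pq: "p \<in> {1..N}" "q \<in> {1..N}"
    using wpq assms permutes_in_image[OF assms(1)] by (metis atLeastAtMost_iff le_SucI Suc_leD)+
  define x where "x = (max p q, min p q)"
  have x: "x \<in> ?P"
    using \<open>p \<noteq> q\<close> pq by (auto simp: x_def max_def min_def)
  have at_x: "?e (transpose k (Suc k) \<circ> w) x = - ?e w x"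
    using \<open>p \<noteq> q\<close> wpq by (auto simp: x_def max_def min_def)
  have off_x: "?e (transpose k (Suc k) \<circ> w) y = ?e w y" if y: "y \<in> ?P - {x}" for y
  proof -
    obtain j i where ji: "y = (j, i)" "i < j" using y by auto
    have inj: "inj w" by (rule permutes_inj[OF assms(1)])
    have "{w j, w i} \<noteq> {k, Suc k}"
    proof
      assume "{w j, w i} = {k, Suc k}"
      then have "{j, i} = {p, q}"
        using inj_image_eq_iff[OF inj, of "{j, i}" "{p, q}"] wpq by auto
      then show False
        using y ji by (auto simp: x_def doubleton_eq_iff max_def min_def)
    qed
    moreover have "w j \<noteq> w i" using ji inj by (auto simp: inj_eq)
    ultimately show ?thesis
      using ji by (simp add: transpose_Suc_less_iff)
  qed
  have split: "inversion_sign N v = ?e v x * prod (?e v) (?P - {x})" for v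
    unfolding inversion_sign_Sigma using x by (intro prod.remove) auto
  have "prod (?e (transpose k (Suc k) \<circ> w)) (?P - {x}) = prod (?e w) (?P - {x})"
    using off_x by (rule prod.cong[OF refl])
  then show ?thesis
    by (simp only: split at_x mult_minus_left)
qed


section \<open>Cancelling the uncoupled permutations\<close>

text \<open>
  The values \<open>2 k - 1\<close> and \<open>2 k\<close> stand in neighbouring positions and have the same color. This is
  the one configuration in which exchanging them changes the flag descents.
\<close>

definition coupled :: "nat \<Rightarrow> nat \<Rightarrow> cperm \<Rightarrow> bool" where
  "coupled N k \<pi> \<longleftrightarrow>
     (\<exists>i\<in>{1..<N}. fst \<pi> ` {i, Suc i} = {2 * k - 1, 2 * k} \<and> snd \<pi> i = snd \<pi> (Suc i))"

definition swap_values :: "nat \<Rightarrow> cperm \<Rightarrow> cperm" where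
  "swap_values k \<pi> = (transpose (2 * k - 1) (2 * k) \<circ> fst \<pi>, snd \<pi>)"

definition signed_weight :: "'a :: comm_ring_1 \<Rightarrow> 'a \<Rightarrow> 'a \<Rightarrow> nat \<Rightarrow> nat \<Rightarrow> cperm \<Rightarrow> 'a" where
  "signed_weight t q x r N \<pi> =
     of_int (inversion_sign N (fst \<pi>)) * t ^ fdes r N \<pi> * q ^ fmaj r N \<pi> * x ^ col N \<pi>"

lemma swap_values_in_colored_perms:
  assumes "\<pi> \<in> colored_perms r (2 * n)" "k \<in> {1..n}"
  shows "swap_values k \<pi> \<in> colored_perms r (2 * n)"
  using assms by (auto simp: colored_perms_def swap_values_def intro!: permutes_compose permutes_swap_id)

lemma swap_values_swap_values: "swap_values k (swap_values k \<pi>) = \<pi>"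
  by (simp add: swap_values_def prod_eq_iff fun_eq_iff)

text \<open>
  Every exchange maps each set \<open>{2 k - 1, 2 k}\<close> to itself. This is what makes the choice of the
  least uncoupled \<open>k\<close> stable, so that repeating the exchange undoes it.
\<close>

lemma coupled_swap_values: "coupled N k (swap_values l \<pi>) \<longleftrightarrow> coupled N k \<pi>"
proof -
  let ?t = "transpose (2 * l - 1) (2 * l)"
  have "?t ` {2 * k - 1, 2 * k} = {2 * k - 1, 2 * k}"
    by (auto simp: transpose_def split: if_splits) presburger+
  then have "(?t \<circ> fst \<pi>) ` A = {2 * k - 1, 2 * k} \<longleftrightarrow> fst \<pi> ` A = {2 * k - 1, 2 * k}" for A
    using inj_image_eq_iff[OF inj_transpose, of "2 * l - 1" "2 * l" "fst \<pi> ` A" "{2 * k - 1, 2 * k}"]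
    by (simp add: image_comp)
  then show ?thesis by (simp add: coupled_def swap_values_def del: image_insert o_apply)
qed

text \<open>
  Neighbouring letters of different colors are compared by color alone. For equal colors the values
  decide, and by assumption they are not exactly \<open>2 k - 1\<close> and \<open>2 k\<close>.
\<close>

lemma Des_F_swap_values:
  assumes "inj (fst \<pi>)" "\<not> coupled N k \<pi>" "k \<ge> 1"
  shows "Des_F N (swap_values k \<pi>) = Des_F N \<pi>"
proof -
  have "flag_less (letter (swap_values k \<pi>) (i + 1)) (letter (swap_values k \<pi>) i)
      \<longleftrightarrow> flag_less (letter \<pi> (i + 1)) (letter \<pi> i)" if i: "i \<in> {1..N - 1}" for i
  proof (cases "snd \<pi> i = snd \<pi> (i + 1)")
    case True
    have k: "Suc (2 * k - 1) = 2 * k" using \<open>k \<ge> 1\<close> by simp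
    have "{fst \<pi> (i + 1), fst \<pi> i} \<noteq> {2 * k - 1, 2 * k}"
    proof
      assume "{fst \<pi> (i + 1), fst \<pi> i} = {2 * k - 1, 2 * k}"
      then have "fst \<pi> ` {i, Suc i} = {2 * k - 1, 2 * k}"
        by (simp add: insert_commute[of "fst \<pi> i"])
      moreover have "i \<in> {1..<N}" using i by auto
      ultimately show False using assms(2) True unfolding coupled_def by auto
    qed
    moreover have "fst \<pi> (i + 1) \<noteq> fst \<pi> i"
      using assms(1) by (simp add: inj_eq)
    ultimately show ?thesis
      using transpose_Suc_less_iff[of "fst \<pi> (i + 1)" "fst \<pi> i" "2 * k - 1", unfolded k] True
      by (simp add: letter_def swap_values_def k)
  next
    case False
    then show ?thesis by (auto simp: letter_def swap_values_def)
  qed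
  then show ?thesis unfolding Des_F_def by blast
qed

lemma signed_weight_swap_values:
  assumes "\<pi> \<in> colored_perms r (2 * n)" "k \<in> {1..n}" "\<not> coupled (2 * n) k \<pi>"
  shows "signed_weight t q x r (2 * n) (swap_values k \<pi>) = - signed_weight t q x r (2 * n) \<pi>"
proof -
  have perm: "fst \<pi> permutes {1..2 * n}"
    using assms(1) by (auto simp: colored_perms_def)
  have "Des_F (2 * n) (swap_values k \<pi>) = Des_F (2 * n) \<pi>"
    using assms by (intro Des_F_swap_values permutes_inj[OF perm]) auto
  moreover have "snd (swap_values k \<pi>) = snd \<pi>"
    by (simp add: swap_values_def)
  moreover have "inversion_sign (2 * n) (fst (swap_values k \<pi>)) = - inversion_sign (2 * n) (fst \<pi>)"
  proof -
    have "Suc (2 * k - 1) = 2 * k" "1 \<le> 2 * k - 1" "2 * k \<le> 2 * n" using assms(2) by auto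
    then show ?thesis
      using inversion_sign_transpose[OF perm, of "2 * k - 1"] by (simp add: swap_values_def)
  qed
  ultimately show ?thesis
    by (simp add: signed_weight_def fdes_def fmaj_def des_F_def maj_F_def col_def)
qed

lemma sum_eq_0_by_sign_reversing_involution:
  fixes f :: "'b \<Rightarrow> 'a :: {idom, ring_char_0}"
  assumes "\<And>a. a \<in> A \<Longrightarrow> \<phi> a \<in> A" "\<And>a. a \<in> A \<Longrightarrow> \<phi> (\<phi> a) = a" "\<And>a. a \<in> A \<Longrightarrow> f (\<phi> a) = - f a"
  shows "sum f A = 0"
proof -
  have "sum f A = sum (\<lambda>a. f (\<phi> a)) A"
    using assms by (intro sum.reindex_bij_witness[of _ \<phi> \<phi>]) auto
  also have "\<dots> = - sum f A"
    by (simp add: assms(3) sum_negf)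
  finally show ?thesis by (simp add: equal_neg_zero)
qed

lemma sum_signed_weight_uncoupled:
  fixes t q x :: "'a :: {idom, ring_char_0}"
  shows "(\<Sum>\<pi>\<in>{\<pi> \<in> colored_perms r (2 * n). \<exists>k\<in>{1..n}. \<not> coupled (2 * n) k \<pi>}.
            signed_weight t q x r (2 * n) \<pi>) = 0"
proof -
  define K where "K \<pi> = (LEAST k. k \<in> {1..n} \<and> \<not> coupled (2 * n) k \<pi>)" for \<pi>
  have K_swap: "K (swap_values l \<pi>) = K \<pi>" for l \<pi>
    by (simp add: K_def coupled_swap_values)
  have K: "K \<pi> \<in> {1..n}" "\<not> coupled (2 * n) (K \<pi>) \<pi>"
    if "\<exists>k\<in>{1..n}. \<not> coupled (2 * n) k \<pi>" for \<pi>
    using LeastI_ex[of "\<lambda>k. k \<in> {1..n} \<and> \<not> coupled (2 * n) k \<pi>"] that unfolding K_def by blast+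
  show ?thesis
  proof (rule sum_eq_0_by_sign_reversing_involution[of _ "\<lambda>\<pi>. swap_values (K \<pi>) \<pi>"], goal_cases)
    case (1 \<pi>)
    then have "\<pi> \<in> colored_perms r (2 * n)" "\<exists>k\<in>{1..n}. \<not> coupled (2 * n) k \<pi>" by simp_all
    then show ?case
      using swap_values_in_colored_perms[OF _ K(1)] by (simp add: coupled_swap_values)
  next
    case (2 \<pi>)
    then show ?case by (simp add: K_swap swap_values_swap_values)
  next
    case (3 \<pi>)
    then have "\<pi> \<in> colored_perms r (2 * n)" "\<exists>k\<in>{1..n}. \<not> coupled (2 * n) k \<pi>" by simp_all
    then show ?case
      using signed_weight_swap_values[OF _ K] by blast
  qed
qed

section \<open>Coupled permutations as colored permutations of half the size\<close>

text \<open>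
  Letter \<open>j\<close> of \<open>\<tau>\<close>, say with value \<open>v\<close>, becomes \<open>2 v - 1, 2 v\<close> in positions \<open>2 j - 1\<close> and \<open>2 j\<close>, or
  \<open>2 v, 2 v - 1\<close> if \<open>j \<in> S\<close>; both letters inherit its color. Position \<open>i\<close> belongs to domino
  \<open>Suc i div 2\<close>. With this formula the conventions outside \<open>{1..2 n}\<close>, identity for values and
  \<open>undefined\<close> for colors, follow from those of \<open>\<tau>\<close> outside \<open>{1..n}\<close>.
\<close>

definition dominoes :: "nat set \<Rightarrow> cperm \<Rightarrow> cperm" where
  "dominoes S \<tau> =
     (\<lambda>i. 2 * fst \<tau> (Suc i div 2) - (if odd i \<longleftrightarrow> Suc i div 2 \<in> S then 0 else 1),
      \<lambda>i. snd \<tau> (Suc i div 2))"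

definition halve :: "cperm \<Rightarrow> cperm" where
  "halve \<pi> = (\<lambda>j. Suc (fst \<pi> (2 * j)) div 2, \<lambda>j. snd \<pi> (2 * j))"

lemma dominoes_odd:
  assumes "j \<ge> 1"
  shows "fst (dominoes S \<tau>) (2 * j - Suc 0) = 2 * fst \<tau> j - (if j \<in> S then 0 else 1)"
    and "snd (dominoes S \<tau>) (2 * j - Suc 0) = snd \<tau> j"
proof -
  obtain m where "j = Suc m" using assms by (cases j) auto
  then have "2 * j - Suc 0 = Suc (2 * m)" "Suc (Suc (2 * m)) div 2 = j" by simp_all
  then show "fst (dominoes S \<tau>) (2 * j - Suc 0) = 2 * fst \<tau> j - (if j \<in> S then 0 else 1)"
    and "snd (dominoes S \<tau>) (2 * j - Suc 0) = snd \<tau> j"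
    unfolding dominoes_def fst_conv snd_conv by simp_all
qed

lemma dominoes_even:
  shows "fst (dominoes S \<tau>) (2 * j) = 2 * fst \<tau> j - (if j \<in> S then 1 else 0)"
    and "snd (dominoes S \<tau>) (2 * j) = snd \<tau> j"
  unfolding dominoes_def fst_conv snd_conv by simp_all

lemma nat_odd_even_cases:
  assumes "i \<in> {1..2 * n :: nat}"
  obtains j where "j \<in> {1..n}" "i = 2 * j - 1" | j where "j \<in> {1..n}" "i = 2 * j"
proof (cases "even i")
  case True
  then have "i = 2 * (i div 2)" by simp
  moreover have "i div 2 \<in> {1..n}" using assms True by auto
  ultimately show ?thesis using that(2) by blast
next
  case False
  then have "i = 2 * (Suc i div 2) - 1" by presburger
  moreover have "Suc i div 2 \<in> {1..n}" using assms by auto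
  ultimately show ?thesis using that(1) by blast
qed

lemma halve_dominoes:
  assumes "fst \<tau> permutes {1..n}" "S \<subseteq> {1..n}"
  shows "halve (dominoes S \<tau>) = \<tau>"
proof -
  have "Suc (fst (dominoes S \<tau>) (2 * j)) div 2 = fst \<tau> j" for j
  proof (cases "j \<in> S")
    case True
    then have "fst \<tau> j \<ge> 1"
      using assms permutes_in_image[OF assms(1), of j] by auto
    then show ?thesis using True by (simp add: dominoes_even)
  qed (simp add: dominoes_even)
  then show ?thesis by (simp add: halve_def prod_eq_iff fun_eq_iff dominoes_even)
qed

lemma dominoes_descents:
  assumes "fst \<tau> permutes {1..n}" "j \<in> {1..n}"
  shows "fst (dominoes S \<tau>) (2 * j) < fst (dominoes S \<tau>) (2 * j - 1) \<longleftrightarrow> j \<in> S"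
  using assms permutes_in_image[OF assms(1), of j]
  by (auto simp: dominoes_even dominoes_odd)

lemma half_in_range_iff: "Suc i div 2 \<in> {1..n} \<longleftrightarrow> i \<in> {1..2 * n}"
  unfolding atLeastAtMost_iff by presburger

lemma dominoes_outside:
  assumes "fst \<tau> permutes {1..n}" "S \<subseteq> {1..n}" "i \<notin> {1..2 * n}"
  shows "fst (dominoes S \<tau>) i = i"
proof -
  have "Suc i div 2 \<notin> S" "fst \<tau> (Suc i div 2) = Suc i div 2"
    using half_in_range_iff[of i n] assms permutes_not_in[OF assms(1)] by blast+
  moreover have "2 * (Suc i div 2) - (if odd i = False then 0 else 1) = i"
    by presburger
  ultimately show ?thesis by (simp only: dominoes_def fst_conv)
qed

lemma domino_letter_eq_iff:
  fixes m m' :: nat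
  assumes "m \<ge> 1" "m' \<ge> 1"
  shows "2 * m - (if P then 0 else 1) = 2 * m' - (if P' then 0 else 1) \<longleftrightarrow> m = m' \<and> (P \<longleftrightarrow> P')"
  using assms by (cases P; cases P'; simp; presburger)

lemma domino_letter_bounds:
  fixes m :: nat
  assumes "m \<in> {1..n}"
  shows "2 * m - (if P then 0 else 1) \<in> {1..2 * n}"
  using assms by auto

lemma dominoes_in_colored_perms:
  assumes \<tau>: "\<tau> \<in> colored_perms r n" and S: "S \<subseteq> {1..n}"
  shows "dominoes S \<tau> \<in> colored_perms r (2 * n)"
proof -
  let ?w = "fst (dominoes S \<tau>)"
  have perm: "fst \<tau> permutes {1..n}" and colors: "snd \<tau> \<in> {1..n} \<rightarrow>\<^sub>E {0..<r}"
    using \<tau> by (auto simp: colored_perms_def)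
  note half = half_in_range_iff[of _ n]
  have w: "?w i = 2 * fst \<tau> (Suc i div 2) - (if odd i \<longleftrightarrow> Suc i div 2 \<in> S then 0 else 1)" for i
    unfolding dominoes_def fst_conv by (rule refl)
  have pos: "fst \<tau> j \<in> {1..n}" if "j \<in> {1..n}" for j
    using that permutes_in_image[OF perm] by blast
  have "?w permutes {1..2 * n}"
  proof (rule inj_imp_permutes)
    show "inj_on ?w {1..2 * n}"
    proof (rule inj_onI)
      fix i i' assume i: "i \<in> {1..2 * n}" "i' \<in> {1..2 * n}" and eq: "?w i = ?w i'"
      have "fst \<tau> (Suc i div 2) \<ge> 1" "fst \<tau> (Suc i' div 2) \<ge> 1"
        using pos[of "Suc i div 2"] pos[of "Suc i' div 2"] half[of i] half[of i'] i
        unfolding atLeastAtMost_iff by blast+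
      note eqs = iffD1[OF domino_letter_eq_iff[OF this] eq[unfolded w]]
      note parity = conjunct2[OF eqs]
      from conjunct1[OF eqs]
      have h: "Suc i div 2 = Suc i' div 2"
        using permutes_inj[OF perm] by (simp only: inj_eq)
      with parity have "odd i = odd i'" by metis
      with h show "i = i'" by presburger
    qed
  next
    fix i assume "i \<in> {1..2 * n}"
    then have "fst \<tau> (Suc i div 2) \<in> {1..n}"
      using pos half by blast
    then show "?w i \<in> {1..2 * n}"
      unfolding w by (rule domino_letter_bounds)
  next
    fix i assume "i \<notin> {1..2 * n}"
    then show "?w i = i" by (rule dominoes_outside[OF perm S])
  qed simp
  moreover have "snd (dominoes S \<tau>) \<in> {1..2 * n} \<rightarrow>\<^sub>E {0..<r}"
    using colors half unfolding PiE_iff extensional_def dominoes_def snd_conv by blast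
  ultimately show ?thesis
    by (simp add: colored_perms_def mem_Times_iff)
qed

lemma coupled_dominoes:
  assumes "fst \<tau> permutes {1..n}" "k \<in> {1..n}"
  shows "coupled (2 * n) k (dominoes S \<tau>)"
proof -
  define j where "j = inv (fst \<tau>) k"
  have \<tau>j: "fst \<tau> j = k"
    using permutes_inverses[OF assms(1)] by (simp add: j_def)
  then have j: "j \<in> {1..n}"
    using permutes_in_image[OF assms(1)] assms(2) by blast
  then have "Suc (2 * j - 1) = 2 * j" by simp
  then have "fst (dominoes S \<tau>) ` {2 * j - 1, Suc (2 * j - 1)} = {2 * k - 1, 2 * k}"
    using j \<tau>j by (auto simp: dominoes_even dominoes_odd)
  moreover have "snd (dominoes S \<tau>) (2 * j - 1) = snd (dominoes S \<tau>) (Suc (2 * j - 1))"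
    using \<open>Suc (2 * j - 1) = 2 * j\<close> j by (simp add: dominoes_even dominoes_odd)
  ultimately show ?thesis
    unfolding coupled_def using j by (intro bexI[of _ "2 * j - 1"]) auto
qed

text \<open>
  The tiling of \<open>{1..2 n}\<close> by dominoes is unique, seen from left to right: if all earlier dominoes
  occupy positions \<open>2 j' - 1, 2 j'\<close>, then the partner of the letter in position \<open>2 j - 1\<close> cannot be on
  its left, because position \<open>2 (j - 1)\<close> is already matched.
\<close>

lemma coupled_aligned:
  assumes perm: "fst \<pi> permutes {1..2 * n}" and coupled: "\<forall>k\<in>{1..n}. coupled (2 * n) k \<pi>"
    and "j \<in> {1..n}"
  shows "\<exists>k\<in>{1..n}. fst \<pi> ` {2 * j - 1, 2 * j} = {2 * k - 1, 2 * k} \<and> snd \<pi> (2 * j - 1) = snd \<pi> (2 * j)"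
  using \<open>j \<in> {1..n}\<close>
proof (induction j rule: less_induct)
  case (less j)
  have inj: "inj (fst \<pi>)" by (rule permutes_inj[OF perm])
  define m where "m = fst \<pi> (2 * j - 1)"
  have "2 * j - 1 \<in> {1..2 * n}" using less.prems by auto
  then have "m \<in> {1..2 * n}"
    by (simp only: m_def permutes_in_image[OF perm])
  define k where "k = Suc m div 2"
  have k: "k \<in> {1..n}" "m \<in> {2 * k - 1, 2 * k}"
    using \<open>m \<in> {1..2 * n}\<close> unfolding k_def atLeastAtMost_iff insert_iff empty_iff by presburger+
  obtain i where i: "i \<in> {1..<2 * n}" "fst \<pi> ` {i, Suc i} = {2 * k - 1, 2 * k}" "snd \<pi> i = snd \<pi> (Suc i)"
    using coupled k(1) unfolding coupled_def by blast
  have "2 * j - 1 \<in> {i, Suc i}"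
    using k(2) i(2) inj by (metis m_def inj_image_mem_iff)
  then consider "i = 2 * j - 1" | "Suc i = 2 * j - 1" by auto
  then show ?case
  proof cases
    case 1
    moreover have "Suc i = 2 * j" using 1 less.prems by simp
    ultimately show ?thesis using i k(1) by metis
  next
    case 2
    define j' where "j' = j - 1"
    have j': "j' < j" "j' \<in> {1..n}" "i = 2 * j'"
      using 2 i(1) less.prems by (auto simp: j'_def)
    obtain k' where k': "fst \<pi> ` {2 * j' - 1, 2 * j'} = {2 * k' - 1, 2 * k'}" "k' \<in> {1..n}"
      using less.IH[OF j'(1,2)] by blast
    have "fst \<pi> i \<in> {2 * k - 1, 2 * k}" "fst \<pi> i \<in> {2 * k' - 1, 2 * k'}"
      using i(2) k'(1) j'(3) by auto
    then have "k = k'" using k(1) k'(2) by auto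
    then have "{2 * j' - 1, 2 * j'} = {i, Suc i}"
      using i(2) k'(1) inj_image_eq_iff[OF inj] by metis
    then show ?thesis using j'(2,3) by (auto simp: doubleton_eq_iff)
  qed
qed

text \<open>
  The inverse of \<open>dominoes\<close>: the second letter of each domino determines the value of the letter of
  \<open>\<tau>\<close>, and comparing it with the first one recovers membership in \<open>S\<close>.
\<close>

lemma coupled_halve:
  assumes \<pi>: "\<pi> \<in> colored_perms r (2 * n)" and coupled: "\<forall>k\<in>{1..n}. coupled (2 * n) k \<pi>"
  defines "S \<equiv> {j \<in> {1..n}. fst \<pi> (2 * j) < fst \<pi> (2 * j - 1)}"
  shows "halve \<pi> \<in> colored_perms r n" and "dominoes S (halve \<pi>) = \<pi>"
proof -
  have perm: "fst \<pi> permutes {1..2 * n}" and colors: "snd \<pi> \<in> {1..2 * n} \<rightarrow>\<^sub>E {0..<r}"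
    using \<pi> by (auto simp: colored_perms_def)
  have inj: "inj (fst \<pi>)" by (rule permutes_inj[OF perm])
  have aligned: "fst \<pi> ` {2 * j - 1, 2 * j} = {2 * fst (halve \<pi>) j - 1, 2 * fst (halve \<pi>) j}"
    "snd \<pi> (2 * j - 1) = snd \<pi> (2 * j)" "fst (halve \<pi>) j \<in> {1..n}" if j: "j \<in> {1..n}" for j
  proof -
    obtain k where k: "k \<in> {1..n}" "fst \<pi> ` {2 * j - 1, 2 * j} = {2 * k - 1, 2 * k}"
      "snd \<pi> (2 * j - 1) = snd \<pi> (2 * j)"
      using coupled_aligned[OF perm coupled j] by blast
    have "fst \<pi> (2 * j) \<in> {2 * k - 1, 2 * k}" using k(2) by auto
    then have "fst (halve \<pi>) j = k" using k(1) by (auto simp: halve_def)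
    with k show "fst \<pi> ` {2 * j - 1, 2 * j} = {2 * fst (halve \<pi>) j - 1, 2 * fst (halve \<pi>) j}"
      "snd \<pi> (2 * j - 1) = snd \<pi> (2 * j)" "fst (halve \<pi>) j \<in> {1..n}" by auto
  qed
  have perm': "fst (halve \<pi>) permutes {1..n}"
  proof (rule inj_imp_permutes)
    show "inj_on (fst (halve \<pi>)) {1..n}"
    proof (rule inj_onI)
      fix j j' assume j: "j \<in> {1..n}" "j' \<in> {1..n}" and "fst (halve \<pi>) j = fst (halve \<pi>) j'"
      then have "fst \<pi> ` {2 * j - 1, 2 * j} = fst \<pi> ` {2 * j' - 1, 2 * j'}"
        using aligned(1) by metis
      then have "{2 * j - 1, 2 * j} = {2 * j' - 1, 2 * j'}"
        by (simp only: inj_image_eq_iff[OF inj])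
      then show "j = j'" using j by (auto simp: doubleton_eq_iff)
    qed
  next
    fix j assume "j \<notin> {1..n}"
    then have "2 * j \<notin> {1..2 * n}" by auto
    then show "fst (halve \<pi>) j = j"
      using permutes_not_in[OF perm] by (simp add: halve_def)
  qed (use aligned(3) in auto)
  have "snd (halve \<pi>) \<in> {1..n} \<rightarrow>\<^sub>E {0..<r}"
    using colors by (auto simp: halve_def PiE_iff extensional_def)
  with perm' show "halve \<pi> \<in> colored_perms r n"
    by (simp add: colored_perms_def mem_Times_iff)
  have odd_even: "fst (dominoes S (halve \<pi>)) (2 * j - 1) = fst \<pi> (2 * j - 1) \<and>
      fst (dominoes S (halve \<pi>)) (2 * j) = fst \<pi> (2 * j)" if j: "j \<in> {1..n}" for j
    using aligned(1)[OF j] aligned(3)[OF j] j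
    by (auto simp: dominoes_odd dominoes_even S_def doubleton_eq_iff)
  have "fst (dominoes S (halve \<pi>)) i = fst \<pi> i \<and> snd (dominoes S (halve \<pi>)) i = snd \<pi> i" for i
  proof (cases "i \<in> {1..2 * n}")
    case True
    then show ?thesis
    proof (cases rule: nat_odd_even_cases)
      case (1 j)
      then show ?thesis using odd_even aligned(2) by (auto simp: dominoes_odd halve_def)
    next
      case (2 j)
      then show ?thesis using odd_even by (auto simp: dominoes_even halve_def)
    qed
  next
    case False
    then have "2 * (Suc i div 2) \<notin> {1..2 * n}"
      unfolding atLeastAtMost_iff by presburger
    moreover have "snd \<pi> l = undefined" if "l \<notin> {1..2 * n}" for l
      using colors that by (auto simp: PiE_iff extensional_def)
    ultimately have "snd \<pi> (2 * (Suc i div 2)) = snd \<pi> i"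
      using False by metis
    then have "snd (dominoes S (halve \<pi>)) i = snd \<pi> i"
      unfolding dominoes_def halve_def snd_conv .
    moreover have "fst (dominoes S (halve \<pi>)) i = i"
      by (rule dominoes_outside[OF perm' _ False]) (auto simp: S_def)
    ultimately show ?thesis using permutes_not_in[OF perm False] by simp
  qed
  then show "dominoes S (halve \<pi>) = \<pi>"
    by (simp add: prod_eq_iff fun_eq_iff)
qed


section \<open>Statistics of a word of dominoes\<close>

lemma sum_pairs:
  fixes f :: "nat \<Rightarrow> 'a :: comm_monoid_add"
  shows "(\<Sum>i\<in>{1..2 * n}. f i) = (\<Sum>j\<in>{1..n}. f (2 * j - 1) + f (2 * j))"
  by (induction n) (simp_all add: add.assoc)

lemma prod_pairs:
  fixes f :: "nat \<Rightarrow> 'a :: comm_monoid_mult"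
  shows "(\<Prod>i\<in>{1..2 * n}. f i) = (\<Prod>j\<in>{1..n}. f (2 * j - 1) * f (2 * j))"
  by (induction n) (simp_all add: mult.assoc)

lemma col_dominoes: "col (2 * n) (dominoes S \<tau>) = 2 * col n \<tau>"
proof -
  have "col (2 * n) (dominoes S \<tau>) = (\<Sum>j\<in>{1..n}. 2 * snd \<tau> j)"
    unfolding col_def sum_pairs
    by (intro sum.cong) (auto simp: dominoes_odd dominoes_even)
  then show ?thesis by (simp add: col_def sum_distrib_left)
qed

text \<open>
  Different dominoes carry disjoint intervals of values, so their letters compare like the
  underlying letters of \<open>\<tau>\<close>.
\<close>

lemma dominoes_less_iff:
  assumes "fst \<tau> permutes {1..n}" "j \<in> {1..n}" "l \<in> {1..n}" "j \<noteq> l"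
    and "i \<in> {2 * j - 1, 2 * j}" "p \<in> {2 * l - 1, 2 * l}"
  shows "fst (dominoes S \<tau>) p < fst (dominoes S \<tau>) i \<longleftrightarrow> fst \<tau> l < fst \<tau> j"
proof -
  have bounds: "2 * fst \<tau> k - 1 \<le> fst (dominoes S \<tau>) m" "fst (dominoes S \<tau>) m \<le> 2 * fst \<tau> k"
    if "k \<in> {1..n}" "m \<in> {2 * k - 1, 2 * k}" for k m
    using that by (auto simp: dominoes_odd dominoes_even)
  have "fst \<tau> j \<ge> 1" "fst \<tau> l \<ge> 1"
    using permutes_in_image[OF assms(1), of j] permutes_in_image[OF assms(1), of l] assms(2,3) by auto
  moreover have "fst \<tau> j \<noteq> fst \<tau> l"
    using permutes_inj[OF assms(1)] assms(4) by (simp add: inj_eq)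
  ultimately show ?thesis
    using bounds[OF assms(2,5)] bounds[OF assms(3,6)] by linarith
qed

text \<open>
  A letter forms inversions with both or with neither of the letters of another domino, so only the
  inversions inside dominoes matter, of which there is one for each element of \<open>S\<close>.
\<close>

lemma inversion_sign_dominoes:
  assumes \<tau>: "fst \<tau> permutes {1..n}" and S: "S \<subseteq> {1..n}"
  shows "inversion_sign (2 * n) (fst (dominoes S \<tau>)) = (-1) ^ card S"
proof -
  let ?w = "fst (dominoes S \<tau>)"
  let ?e = "\<lambda>p i. if ?w p < ?w i then -1 else 1 :: int"
  have "inversion_sign (2 * m) ?w = (\<Prod>j\<in>{1..m}. if j \<in> S then -1 else 1)" if "m \<le> n" for m
    using that
  proof (induction m)
    case 0
    then show ?case by (simp add: inversion_sign_def)
  next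
    case (Suc m)
    have row: "(\<Prod>i\<in>{1..2 * m}. ?e p i) = 1" if p: "p \<in> {2 * Suc m - 1, 2 * Suc m}" for p
    proof -
      have "?e p (2 * j - 1) * ?e p (2 * j) = 1" if "j \<in> {1..m}" for j
        using dominoes_less_iff[OF \<tau>, of j "Suc m" _ p S] that p Suc.prems by auto
      then show ?thesis unfolding prod_pairs by (intro prod.neutral) auto
    qed
    have "inversion_sign (2 * Suc m) ?w
        = inversion_sign (2 * m) ?w * (\<Prod>i\<in>{1..2 * m}. ?e (Suc (2 * m)) i)
          * ((\<Prod>i\<in>{1..2 * m}. ?e (2 * Suc m) i) * ?e (2 * Suc m) (Suc (2 * m)))"
      using inversion_sign_Suc[of "Suc (2 * m)" ?w] inversion_sign_Suc[of "2 * m" ?w]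
      by (simp del: prod.op_ivl_Suc)
    also have "\<dots> = inversion_sign (2 * m) ?w * ?e (2 * Suc m) (Suc (2 * m))"
      using row[of "Suc (2 * m)"] row[of "2 * Suc m"] by simp
    also have "?e (2 * Suc m) (Suc (2 * m)) = (if Suc m \<in> S then -1 else 1)"
      using dominoes_descents[OF \<tau>, of "Suc m" S] Suc.prems by simp
    finally show ?case using Suc by simp
  qed
  moreover have "{j \<in> {1..n}. j \<in> S} = S" using S by auto
  ultimately show ?thesis
    using minus_one_power_card[of "{1..n}" "\<lambda>j. j \<in> S", where 'a = int] by simp
qed

lemma Des_F_dominoes:
  assumes \<tau>: "fst \<tau> permutes {1..n}" and S: "S \<subseteq> {1..n}"
  shows "Des_F (2 * n) (dominoes S \<tau>) = (\<lambda>j. 2 * j) ` Des_F n \<tau> \<union> (\<lambda>j. 2 * j - 1) ` S"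
proof -
  let ?D = "dominoes S \<tau>"
  have odd_pos: "2 * j - 1 \<in> Des_F (2 * n) ?D \<longleftrightarrow> j \<in> S" if j: "j \<in> {1..n}" for j
  proof -
    have "2 * j - 1 + 1 = 2 * j" "2 * j - 1 \<in> {1..2 * n - 1}" using j by auto
    then have "2 * j - 1 \<in> Des_F (2 * n) ?D \<longleftrightarrow> fst ?D (2 * j) < fst ?D (2 * j - 1)"
      using j by (simp add: Des_F_def letter_def dominoes_odd dominoes_even)
    then show ?thesis using dominoes_descents[OF \<tau> j] by simp
  qed
  have even_pos: "2 * j \<in> Des_F (2 * n) ?D \<longleftrightarrow> j \<in> Des_F n \<tau>" if j: "j \<in> {1..n}" for j
  proof (cases "j = n")
    case True
    with j show ?thesis by (auto simp: Des_F_def)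
  next
    case False
    then have j': "Suc j \<in> {1..n}" "2 * j \<in> {1..2 * n - 1}" "j \<in> {1..n - 1}" using j by auto
    have next_pos: "2 * j + 1 = 2 * Suc j - 1" by simp
    have "snd ?D (2 * j + 1) = snd \<tau> (j + 1)"
      unfolding next_pos using dominoes_odd(2)[of "Suc j"] by simp
    moreover have "fst ?D (2 * j + 1) < fst ?D (2 * j) \<longleftrightarrow> fst \<tau> (j + 1) < fst \<tau> j"
      unfolding next_pos using dominoes_less_iff[OF \<tau> j j'(1), of "2 * j" "2 * Suc j - 1" S] by simp
    ultimately show ?thesis
      using j' by (simp add: Des_F_def letter_def dominoes_even)
  qed
  show ?thesis
  proof (rule set_eqI)
    fix i
    show "i \<in> Des_F (2 * n) ?D \<longleftrightarrow> i \<in> (\<lambda>j. 2 * j) ` Des_F n \<tau> \<union> (\<lambda>j. 2 * j - 1) ` S"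
    proof (cases "i \<in> {1..2 * n}")
      case True
      then show ?thesis
      proof (cases rule: nat_odd_even_cases)
        case (1 j)
        have "2 * j - 1 \<noteq> 2 * l" for l using 1(1) by (simp; presburger)
        moreover have "2 * j - 1 = 2 * l - 1 \<longleftrightarrow> j = l" if "l \<in> S" for l
          using 1(1) S that by auto
        ultimately show ?thesis
          unfolding 1(2) odd_pos[OF 1(1)] by blast
      next
        case (2 j)
        have "2 * j \<noteq> 2 * l - 1" if "l \<in> S" for l
        proof -
          have "l \<ge> 1" using S that by auto
          then show ?thesis by presburger
        qed
        then show ?thesis
          unfolding 2(2) even_pos[OF 2(1)] by auto
      qed
    next
      case False
      moreover have "Des_F (2 * n) ?D \<subseteq> {1..2 * n}" "(\<lambda>j. 2 * j) ` Des_F n \<tau> \<subseteq> {1..2 * n}"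
        by (auto simp: Des_F_def)
      moreover have "2 * j - 1 \<in> {1..2 * n}" if "j \<in> S" for j
        using subsetD[OF S that] by auto
      ultimately show ?thesis by blast
    qed
  qed
qed

lemma
  assumes \<tau>: "fst \<tau> permutes {1..n}" and S: "S \<subseteq> {1..n}"
  shows des_F_dominoes: "des_F (2 * n) (dominoes S \<tau>) = des_F n \<tau> + card S"
    and maj_F_dominoes: "maj_F (2 * n) (dominoes S \<tau>) = 2 * maj_F n \<tau> + (\<Sum>j\<in>S. 2 * j - 1)"
proof -
  have fin: "finite (Des_F n \<tau>)" "finite S"
    using S finite_subset by (auto simp: Des_F_def)
  have pos: "j \<ge> 1" if "j \<in> S" for j using S that by auto
  have disj: "(\<lambda>j. 2 * j) ` Des_F n \<tau> \<inter> (\<lambda>j. 2 * j - 1) ` S = {}"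
  proof -
    have "2 * j \<noteq> 2 * l - 1" if "l \<in> S" for j l
      using pos[OF that] by presburger
    then show ?thesis by blast
  qed
  have inj: "inj_on (\<lambda>j::nat. 2 * j) (Des_F n \<tau>)" "inj_on (\<lambda>j. 2 * j - Suc 0) S"
  proof -
    have "j = l" if "j \<in> S" "l \<in> S" "2 * j - Suc 0 = 2 * l - Suc 0" for j l
      using pos[OF that(1)] pos[OF that(2)] that(3) by linarith
    then show "inj_on (\<lambda>j. 2 * j - Suc 0) S" by (intro inj_onI)
  qed (simp add: inj_on_def)
  show "des_F (2 * n) (dominoes S \<tau>) = des_F n \<tau> + card S"
    unfolding des_F_def Des_F_dominoes[OF assms]
    by (subst card_Un_disjoint) (use fin disj in \<open>auto simp: card_image inj\<close>)
  show "maj_F (2 * n) (dominoes S \<tau>) = 2 * maj_F n \<tau> + (\<Sum>j\<in>S. 2 * j - 1)"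
    unfolding maj_F_def Des_F_dominoes[OF assms]
    by (subst sum.union_disjoint)
      (use fin disj in \<open>auto simp: sum.reindex inj sum_distrib_left\<close>)
qed

lemma signed_weight_dominoes:
  assumes \<tau>: "fst \<tau> permutes {1..n}" and S: "S \<subseteq> {1..n}"
  shows "signed_weight t q x r (2 * n) (dominoes S \<tau>) =
    (-1) ^ card S * (\<Prod>j\<in>S. t ^ r * q ^ (r * (2 * j - 1)))
      * (t ^ fdes r n \<tau> * q ^ (2 * fmaj r n \<tau>) * x ^ (2 * col n \<tau>))"
proof -
  have "snd (dominoes S \<tau>) 1 = snd \<tau> 1"
    using dominoes_odd(2)[of 1] by simp
  then have "fdes r (2 * n) (dominoes S \<tau>) = r * card S + fdes r n \<tau>"
    by (simp add: fdes_def des_F_dominoes[OF assms] distrib_left)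
  moreover have "fmaj r (2 * n) (dominoes S \<tau>) = (\<Sum>j\<in>S. r * (2 * j - 1)) + 2 * fmaj r n \<tau>"
    unfolding fmaj_def maj_F_dominoes[OF assms] col_dominoes sum_distrib_left[symmetric]
    by (simp only: algebra_simps)
  moreover have "(\<Prod>j\<in>S. t ^ r * q ^ (r * (2 * j - 1))) = t ^ (r * card S) * q ^ (\<Sum>j\<in>S. r * (2 * j - 1))"
    by (simp add: prod.distrib power_mult power_sum)
  ultimately show ?thesis
    unfolding signed_weight_def inversion_sign_dominoes[OF assms] col_dominoes
    by (simp add: power_add ac_simps)
qed

section \<open>The signed enumerator\<close>

text \<open>
  The sum over \<open>S\<close> separates from the sum over \<open>\<tau>\<close> and is the expansion of the product.
\<close>

lemma sum_signed_weight_coupled: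
  fixes t q x :: "'a :: comm_ring_1"
  shows "(\<Sum>\<pi>\<in>{\<pi> \<in> colored_perms r (2 * n). \<forall>k\<in>{1..n}. coupled (2 * n) k \<pi>}.
            signed_weight t q x r (2 * n) \<pi>)
     = (\<Prod>i=1..n. 1 - t ^ r * q ^ (r * (2 * i - 1)))
       * (\<Sum>\<tau>\<in>colored_perms r n. t ^ fdes r n \<tau> * q ^ (2 * fmaj r n \<tau>) * x ^ (2 * col n \<tau>))"
proof -
  let ?C = "{\<pi> \<in> colored_perms r (2 * n). \<forall>k\<in>{1..n}. coupled (2 * n) k \<pi>}"
  let ?desc = "\<lambda>\<pi>. {j \<in> {1..n}. fst \<pi> (2 * j) < fst \<pi> (2 * j - 1)}"
  let ?g = "\<lambda>S. (-1) ^ card S * (\<Prod>j\<in>S. t ^ r * q ^ (r * (2 * j - 1)))"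
  let ?h = "\<lambda>\<tau>. t ^ fdes r n \<tau> * q ^ (2 * fmaj r n \<tau>) * x ^ (2 * col n \<tau>)"
  have perm: "fst \<tau> permutes {1..n}" if "\<tau> \<in> colored_perms r n" for \<tau>
    using that by (auto simp: colored_perms_def)
  have "(\<Sum>\<pi>\<in>?C. signed_weight t q x r (2 * n) \<pi>)
      = (\<Sum>(S, \<tau>)\<in>Pow {1..n} \<times> colored_perms r n. ?g S * ?h \<tau>)"
  proof (rule sum.reindex_bij_witness[of _ "\<lambda>(S, \<tau>). dominoes S \<tau>" "\<lambda>\<pi>. (?desc \<pi>, halve \<pi>)"], goal_cases)
    case (1 \<pi>)
    then show ?case using coupled_halve(2)[of \<pi> r n] by simp
  next
    case (2 \<pi>)
    then show ?case using coupled_halve(1)[of \<pi> r n] by blast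
  next
    case (3 p)
    then obtain S \<tau> where p: "p = (S, \<tau>)" "S \<subseteq> {1..n}" "\<tau> \<in> colored_perms r n" by auto
    have "?desc (dominoes S \<tau>) = S"
      using dominoes_descents[OF perm[OF p(3)]] p(2) by blast
    then show ?case
      using halve_dominoes[OF perm[OF p(3)] p(2)] by (simp only: p(1) prod.case)
  next
    case (4 p)
    then show ?case using dominoes_in_colored_perms coupled_dominoes perm by fastforce
  next
    case (5 \<pi>)
    then have \<pi>: "\<pi> \<in> colored_perms r (2 * n)" "\<forall>k\<in>{1..n}. coupled (2 * n) k \<pi>" by simp_all
    have "signed_weight t q x r (2 * n) (dominoes (?desc \<pi>) (halve \<pi>)) = ?g (?desc \<pi>) * ?h (halve \<pi>)"
      by (rule signed_weight_dominoes[OF perm[OF coupled_halve(1)[OF \<pi>]]]) auto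
    then show ?case using coupled_halve(2)[OF \<pi>] by simp
  qed
  also have "\<dots> = (\<Sum>S\<in>Pow {1..n}. ?g S) * (\<Sum>\<tau>\<in>colored_perms r n. ?h \<tau>)"
    by (simp add: sum_product sum.cartesian_product)
  also have "(\<Sum>S\<in>Pow {1..n}. ?g S) = (\<Prod>i=1..n. 1 - t ^ r * q ^ (r * (2 * i - 1)))"
    by (subst prod_diff_conv_sum) simp_all
  finally show ?thesis .
qed

lemma finite_colored_perms: "finite (colored_perms r N)"
  unfolding colored_perms_def
  by (intro finite_cartesian_product finite_permutations finite_PiE) auto

lemma sum_signed_weight:
  fixes t q x :: "'a :: {idom, ring_char_0}"
  shows "(\<Sum>\<pi>\<in>colored_perms r (2 * n). signed_weight t q x r (2 * n) \<pi>)
     = (\<Prod>i=1..n. 1 - t ^ r * q ^ (r * (2 * i - 1)))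
       * (\<Sum>\<tau>\<in>colored_perms r n. t ^ fdes r n \<tau> * q ^ (2 * fmaj r n \<tau>) * x ^ (2 * col n \<tau>))"
proof -
  let ?G = "colored_perms r (2 * n)"
  let ?C = "{\<pi> \<in> ?G. \<forall>k\<in>{1..n}. coupled (2 * n) k \<pi>}"
  let ?U = "{\<pi> \<in> ?G. \<exists>k\<in>{1..n}. \<not> coupled (2 * n) k \<pi>}"
  have "?G - ?C = ?U" by blast
  then have "(\<Sum>\<pi>\<in>?G. signed_weight t q x r (2 * n) \<pi>)
      = (\<Sum>\<pi>\<in>?U. signed_weight t q x r (2 * n) \<pi>) + (\<Sum>\<pi>\<in>?C. signed_weight t q x r (2 * n) \<pi>)"
    using sum.subset_diff[of ?C ?G "signed_weight t q x r (2 * n)"] finite_colored_perms by auto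
  then show ?thesis
    by (simp only: sum_signed_weight_uncoupled sum_signed_weight_coupled add_0)
qed

lemma scalar_mult: "scalar (c * d) = scalar c * scalar d"
  by (simp add: scalar_def)

lemma scalar_1: "scalar 1 = 1"
  by (simp add: scalar_def one_pCons)

lemma scalar_power: "scalar (c ^ k) = scalar c ^ k"
  by (induction k) (simp_all add: scalar_1 scalar_mult)

lemma scalar_of_int: "scalar (of_int k) = of_int k"
  by (simp add: scalar_def of_int_poly)

text \<open>
  The sign becomes the integer that occurs in \<open>signed_weight\<close>, and the power of \<open>\<omega> ^ b\<close> has the
  exponent \<open>col\<close>, so that it combines with \<open>var_x\<close>.
\<close>

lemma scalar_chi:
  assumes "fst \<pi> permutes {1..N}"
  shows "scalar (chi \<omega> N 1 b \<pi>) = of_int (inversion_sign N (fst \<pi>)) * scalar (\<omega> ^ b) ^ col N \<pi>"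
proof -
  have "chi \<omega> N 1 b \<pi> = of_int ((-1) ^ (clength N \<pi> - col N \<pi>)) * (\<omega> ^ b) ^ col N \<pi>"
    by (simp add: chi_def power_mult)
  then show ?thesis
    by (simp only: minus_one_power_length[OF assms] scalar_mult scalar_power scalar_of_int)
qed

theorem theorem1:
  fixes r n b :: nat and \<omega> :: complex
  assumes "r \<ge> 1" and "n \<ge> 1"
    and "primitive_root_of_1 r \<omega>"
    and "b \<le> r - 1"
  shows
    "(\<Sum>\<pi>\<in>colored_perms r (2 * n).
        scalar (chi \<omega> (2 * n) 1 b \<pi>)
          * var_t ^ fdes r (2 * n) \<pi> * var_q ^ fmaj r (2 * n) \<pi> * var_x ^ col (2 * n) \<pi>)
     = (\<Prod>i=1..n. 1 - var_t ^ r * var_q ^ (r * (2 * i - 1)))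
       * (\<Sum>\<pi>\<in>colored_perms r n.
            var_t ^ fdes r n \<pi> * (scalar (\<omega> ^ b) * var_q) ^ (2 * fmaj r n \<pi>)
              * var_x ^ (2 * col n \<pi>))"
proof -
  let ?c = "scalar (\<omega> ^ b)"
  have "(\<omega> ^ b) ^ r = (\<omega> ^ r) ^ b" by (simp only: power_mult[symmetric] mult.commute)
  then have "(\<omega> ^ b) ^ r = 1" using assms(3) by (simp add: primitive_root_of_1_def)
  then have c_r: "?c ^ r = 1" by (simp only: scalar_power[symmetric] scalar_1)
  \<comment> \<open>\<open>fmaj\<close> and \<open>col\<close> agree modulo \<open>r\<close>, so the factor \<open>\<omega> ^ b\<close> may be moved from \<open>q\<close> to \<open>x\<close>.\<close>
  have c_fmaj: "?c ^ (2 * fmaj r n \<tau>) = ?c ^ (2 * col n \<tau>)" for \<tau>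
  proof -
    have "2 * fmaj r n \<tau> = r * (2 * maj_F n \<tau>) + 2 * col n \<tau>" by (simp add: fmaj_def)
    then show ?thesis by (simp only: power_add power_mult[of ?c r] c_r power_one mult_1)
  qed
  have "(\<Sum>\<pi>\<in>colored_perms r (2 * n).
        scalar (chi \<omega> (2 * n) 1 b \<pi>)
          * var_t ^ fdes r (2 * n) \<pi> * var_q ^ fmaj r (2 * n) \<pi> * var_x ^ col (2 * n) \<pi>)
      = (\<Sum>\<pi>\<in>colored_perms r (2 * n). signed_weight var_t var_q (?c * var_x) r (2 * n) \<pi>)"
  proof (rule sum.cong[OF refl])
    fix \<pi> assume "\<pi> \<in> colored_perms r (2 * n)"
    then have "fst \<pi> permutes {1..2 * n}" by (auto simp: colored_perms_def)
    then show "scalar (chi \<omega> (2 * n) 1 b \<pi>)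
          * var_t ^ fdes r (2 * n) \<pi> * var_q ^ fmaj r (2 * n) \<pi> * var_x ^ col (2 * n) \<pi>
        = signed_weight var_t var_q (?c * var_x) r (2 * n) \<pi>"
      by (simp only: scalar_chi signed_weight_def power_mult_distrib mult_ac)
  qed
  also have "\<dots> = (\<Prod>i=1..n. 1 - var_t ^ r * var_q ^ (r * (2 * i - 1)))
       * (\<Sum>\<tau>\<in>colored_perms r n.
            var_t ^ fdes r n \<tau> * var_q ^ (2 * fmaj r n \<tau>) * (?c * var_x) ^ (2 * col n \<tau>))"
    by (rule sum_signed_weight)
  also have "(\<Sum>\<tau>\<in>colored_perms r n.
            var_t ^ fdes r n \<tau> * var_q ^ (2 * fmaj r n \<tau>) * (?c * var_x) ^ (2 * col n \<tau>))
      = (\<Sum>\<tau>\<in>colored_perms r n.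
            var_t ^ fdes r n \<tau> * (?c * var_q) ^ (2 * fmaj r n \<tau>) * var_x ^ (2 * col n \<tau>))"
    by (simp only: power_mult_distrib c_fmaj mult_ac)
  finally show ?thesis .
qed

end
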